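(* Let $n\ge1$, let $x\in H$, let $y_1,\dots,y_n\in H$ be non-zero vectors, and let $\alpha_1,\dots,\alpha_n\in\mathbb{K}$. Let $F$ be any one of the following three quantities: \begin{itemize} \item[(F1)] $\max_{1\le i\le n}|\alpha_i|^2\,\sum_{i=1}^n\|y_i\|^2$; \item[(F2)] $\left(\sum_{i=1}^n|\alpha_i|^{2p}\right)^{1/p}\left(\sum_{i=1}^n\|y_i\|^{2q}\right)^{1/q}$, where $p>1$ and $\frac1p+\frac1q=1$; \item[(F3)] $\sum_{i=1}^n|\alpha_i|^2\,\max_{1\le i\le n}\|y_i\|^2$; \end{itemize} and let $G$ be any one of the following three quantities: \begin{itemize} \item[(G1)] $\max_{1\le i\ne j\le n}\{|\alpha_i||\alpha_j|\}\,\sum_{1\le i\ne j\le n}|(y_i,y_j)|$; \item[(G2)] $\left[\left(\sum_{i=1}^n|\alpha_i|^{r}\right)^2-\sum_{i=1}^n|\alpha_i|^{2r}\right]^{1/r}\left(\sum_{1\le i\ne j\le n}|(y_i,y_j)|^s\right)^{1/s}$, where $r>1$ and $\frac1r+\frac1s=1$; \item[(G3)] $\left[\left(\sum_{i=1}^n|\alpha_i|\right)^2-\sum_{i=1}^n|\alpha_i|^2\right]\max_{1\le i\ne j\le n}|(y_i,y_j)|$. \end{itemize} Then, for each of the nine possible choices of the pair $(F,G)$, $$\left\|\sum_{i=1}^n\alpha_i\frac{(x,y_i)}{\|y_i\|}\,y_i\right\|^2\le \|x\|^2F+\|x\|^2G.$$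
   Context: $H$ is a real or complex Hilbert space with scalar field $\mathbb{K}\in\{\mathbb{R},\mathbb{C}\}$, inner product $(\cdot,\cdot)$ (linear in the first variable) and norm $\|\cdot\|$. Sums and maxima over $1\le i\ne j\le n$ run over all ordered pairs $(i,j)\in\{1,\dots,n\}^2$ with $i\neq j$; if $n=1$, such sums and maxima are taken to be $0$. *)

theory Defs
  imports "HOL-Analysis.Analysis"
begin

text \<open>
  Real Hilbert spaces are types of sort \<open>{real_inner, complete_space}\<close>. The classes below are the
  complex counterpart; the inner product is linear in its first argument, and the norm (hence the
  metric in which completeness is required) is the one it induces.
\<close>

class complex_inner = real_normed_vector +
  fixes scaleC :: "complex \<Rightarrow> 'a \<Rightarrow> 'a" (infixr "*\<^sub>C" 75)
    and cinner :: "'a \<Rightarrow> 'a \<Rightarrow> complex"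
  assumes scaleC_of_real: "complex_of_real r *\<^sub>C x = r *\<^sub>R x"
    and scaleC_add_right: "c *\<^sub>C (x + y) = c *\<^sub>C x + c *\<^sub>C y"
    and scaleC_add_left: "(c + d) *\<^sub>C x = c *\<^sub>C x + d *\<^sub>C x"
    and scaleC_scaleC: "c *\<^sub>C (d *\<^sub>C x) = (c * d) *\<^sub>C x"
    and cinner_add_left: "cinner (x + y) z = cinner x z + cinner y z"
    and cinner_scaleC_left: "cinner (c *\<^sub>C x) y = c * cinner x y"
    and cinner_commute: "cinner x y = cnj (cinner y x)"
    and cinner_ge_zero: "0 \<le> Re (cinner x x)"
    and norm_eq_sqrt_cinner: "norm x = sqrt (Re (cinner x x))"

class complex_hilbert = complex_inner + complete_space

instantiation complex :: complex_hilbert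
begin

definition scaleC_complex :: "complex \<Rightarrow> complex \<Rightarrow> complex"
  where "scaleC_complex c x = c * x"

definition cinner_complex :: "complex \<Rightarrow> complex \<Rightarrow> complex"
  where "cinner_complex x y = x * cnj y"

instance
  by standard
    (auto simp: scaleC_complex_def cinner_complex_def scaleR_conv_of_real algebra_simps
      cmod_def power2_eq_square)

end

definition offdiag :: "nat \<Rightarrow> (nat \<times> nat) set"
  where "offdiag n = {(i, j). i \<in> {1..n} \<and> j \<in> {1..n} \<and> i \<noteq> j}"

text \<open>A maximum over pairs \<open>i \<noteq> j\<close>, with the convention that it is \<open>0\<close> if there are none.\<close>

definition Max_offdiag :: "nat \<Rightarrow> (nat \<Rightarrow> nat \<Rightarrow> real) \<Rightarrow> real"
  where "Max_offdiag n f =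
    (if offdiag n = {} then 0 else Max ((\<lambda>(i, j). f i j) ` offdiag n))"

text \<open>
  The admissible values of the diagonal quantity \<open>F\<close> and the off-diagonal quantity \<open>G\<close>. Both are
  polymorphic in the scalar type so as to serve the real and the complex case; \<open>ip\<close> is the inner
  product.
\<close>

definition diag_bounds ::
    "nat \<Rightarrow> (nat \<Rightarrow> 'k::real_normed_field) \<Rightarrow> (nat \<Rightarrow> 'a::real_normed_vector) \<Rightarrow> real set"
  where "diag_bounds n \<alpha> y =
    {Max ((\<lambda>i. (norm (\<alpha> i))\<^sup>2) ` {1..n}) * (\<Sum>i=1..n. (norm (y i))\<^sup>2)} \<union>
    {(\<Sum>i=1..n. norm (\<alpha> i) powr (2 * p)) powr (1 / p) *
       (\<Sum>i=1..n. norm (y i) powr (2 * q)) powr (1 / q) | p q. p > 1 \<and> 1 / p + 1 / q = 1} \<union>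
    {(\<Sum>i=1..n. (norm (\<alpha> i))\<^sup>2) * Max ((\<lambda>i. (norm (y i))\<^sup>2) ` {1..n})}"

definition offdiag_bounds ::
    "('a \<Rightarrow> 'a \<Rightarrow> 'k) \<Rightarrow> nat \<Rightarrow> (nat \<Rightarrow> 'k::real_normed_field) \<Rightarrow> (nat \<Rightarrow> 'a) \<Rightarrow> real set"
  where "offdiag_bounds ip n \<alpha> y =
    {Max_offdiag n (\<lambda>i j. norm (\<alpha> i) * norm (\<alpha> j)) *
       (\<Sum>(i, j)\<in>offdiag n. norm (ip (y i) (y j)))} \<union>
    {((\<Sum>i=1..n. norm (\<alpha> i) powr r)\<^sup>2 - (\<Sum>i=1..n. norm (\<alpha> i) powr (2 * r))) powr (1 / r) *
       (\<Sum>(i, j)\<in>offdiag n. norm (ip (y i) (y j)) powr s) powr (1 / s)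
       | r s. r > 1 \<and> 1 / r + 1 / s = 1} \<union>
    {((\<Sum>i=1..n. norm (\<alpha> i))\<^sup>2 - (\<Sum>i=1..n. (norm (\<alpha> i))\<^sup>2)) *
       Max_offdiag n (\<lambda>i j. norm (ip (y i) (y j)))}"

end

theory Submission
  imports Defs
begin

text \<open>
  Put \<open>c\<^sub>i = \<alpha>\<^sub>i (x, y\<^sub>i) / \<parallel>y\<^sub>i\<parallel>\<close>. The Cauchy--Schwarz inequality absorbs the normalisation of
  \<open>y\<^sub>i\<close> and gives \<open>\<bar>c\<^sub>i\<bar> \<le> \<bar>\<alpha>\<^sub>i\<bar> \<parallel>x\<parallel>\<close>. Expanding the square of the norm of \<open>\<Sum> c\<^sub>i y\<^sub>i\<close> into the
  double sum of the terms \<open>c\<^sub>i cnj c\<^sub>j (y\<^sub>i, y\<^sub>j)\<close>, taking absolute values, and separating the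
  diagonal from the rest bounds it by \<open>\<parallel>x\<parallel>\<^sup>2 (D + E)\<close>, where
  \<open>D = \<Sum>\<^sub>i \<bar>\<alpha>\<^sub>i\<bar>\<^sup>2 \<parallel>y\<^sub>i\<parallel>\<^sup>2\<close> and \<open>E\<close> is the sum of \<open>\<bar>\<alpha>\<^sub>i\<bar> \<bar>\<alpha>\<^sub>j\<bar> \<bar>(y\<^sub>i, y\<^sub>j)\<bar>\<close> over the pairs with
  \<open>i \<noteq> j\<close>.

  The diagonal and the off-diagonal parts are now independent of each other, and each is a sum of
  products of two nonnegative families. The three choices for \<open>F\<close>, and likewise those for \<open>G\<close>, are
  Hoelder's inequality for such a sum with the exponent pairs \<open>(\<infinity>, 1)\<close>, \<open>(p, q)\<close> and \<open>(1, \<infinity>)\<close>: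
  lemmas \<open>diag_sum_le\<close> and \<open>offdiag_sum_le\<close>. The differences of power sums in the last two choices
  for \<open>G\<close> arise because the sum of \<open>a\<^sub>i a\<^sub>j\<close> over \<open>i \<noteq> j\<close> is the square of the sum of all \<open>a\<^sub>i\<close> less the sum of
  their squares.

  The real and the complex case differ only in how the norm is expanded and in where the
  Cauchy--Schwarz inequality comes from; lemma \<open>norm_bound_of_expansion\<close> contains what they share.
\<close>

section \<open>Hoelder's inequality for finite sums\<close>

lemma sum_mult_le_Max_mult_sum:
  fixes f g :: "'i \<Rightarrow> real"
  assumes "finite A" "\<And>i. i \<in> A \<Longrightarrow> 0 \<le> g i"
  shows "(\<Sum>i\<in>A. f i * g i) \<le> Max (f ` A) * (\<Sum>i\<in>A. g i)"
  unfolding sum_distrib_left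
  by (intro sum_mono mult_right_mono Max_ge) (use assms in auto)

text \<open>
  After both families are scaled to have norm \<open>1\<close>, this is Young's inequality summed over the index
  set; the scaling is impossible only if one family vanishes, and then so does the left-hand side.
\<close>

lemma Hoelder_sum:
  fixes f g :: "'i \<Rightarrow> real"
  assumes fin: "finite A" and f: "\<And>i. i \<in> A \<Longrightarrow> 0 \<le> f i" and g: "\<And>i. i \<in> A \<Longrightarrow> 0 \<le> g i"
    and p: "p > 1" and pq: "1 / p + 1 / q = 1"
  shows "(\<Sum>i\<in>A. f i * g i)
    \<le> (\<Sum>i\<in>A. f i powr p) powr (1 / p) * (\<Sum>i\<in>A. g i powr q) powr (1 / q)"
proof -
  have "0 < 1 / p" "1 / p < 1" using p by simp_all
  then have "0 < 1 / q" "1 / q < 1" using pq by linarith+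
  then have q: "q > 1" by (simp add: zero_less_divide_iff divide_less_eq_1)
  define S where "S = (\<Sum>i\<in>A. f i powr p)"
  define T where "T = (\<Sum>i\<in>A. g i powr q)"
  have S0: "S \<ge> 0" and T0: "T \<ge> 0" unfolding S_def T_def by (auto intro: sum_nonneg)
  show ?thesis
  proof (cases "S = 0 \<or> T = 0")
    case True
    then have "\<forall>i\<in>A. f i = 0 \<or> g i = 0"
      unfolding S_def T_def using fin by (auto simp: sum_nonneg_eq_0_iff)
    then have "(\<Sum>i\<in>A. f i * g i) = 0" by (intro sum.neutral) auto
    then show ?thesis by simp
  next
    case False
    then have S: "S > 0" and T: "T > 0" using S0 T0 by auto
    define a where "a = S powr (1 / p)"
    define b where "b = T powr (1 / q)"
    have a: "a > 0" "a powr p = S" and b: "b > 0" "b powr q = T"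
      using S T p q by (auto simp: a_def b_def powr_powr)
    have "(f i / a) * (g i / b) \<le> f i powr p / S / p + g i powr q / T / q" if "i \<in> A" for i
      using Youngs_inequality[of p q "f i / a" "g i / b"] p q pq f[OF that] g[OF that] a b
      by (simp add: powr_divide)
    then have "(\<Sum>i\<in>A. (f i / a) * (g i / b)) \<le> (\<Sum>i\<in>A. f i powr p / S / p + g i powr q / T / q)"
      by (rule sum_mono)
    also have "\<dots> = S / S / p + T / T / q"
      by (simp add: sum.distrib S_def T_def flip: sum_divide_distrib)
    also have "\<dots> = 1" using S T pq by simp
    finally have "(\<Sum>i\<in>A. f i * g i) / (a * b) \<le> 1"
      by (simp add: sum_divide_distrib)
    then show ?thesis
      using a(1) b(1) by (simp add: a_def b_def S_def T_def)
  qed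
qed

section \<open>The diagonal and the off-diagonal sums\<close>

lemma diag_sum_le:
  fixes \<alpha> :: "nat \<Rightarrow> 'k::real_normed_field" and y :: "nat \<Rightarrow> 'a::real_normed_vector"
  assumes "F \<in> diag_bounds n \<alpha> y"
  shows "(\<Sum>i=1..n. (norm (\<alpha> i))\<^sup>2 * (norm (y i))\<^sup>2) \<le> F"
proof -
  have sq: "(t\<^sup>2) powr p = t powr (2 * p)" if "t \<ge> 0" for t p :: real
    using that by (cases "t = 0") (auto simp: powr_powr simp flip: powr_numeral)
  from assms consider
      (max_left) "F = Max ((\<lambda>i. (norm (\<alpha> i))\<^sup>2) ` {1..n}) * (\<Sum>i=1..n. (norm (y i))\<^sup>2)"
    | (conjugate) p q where "p > 1" "1 / p + 1 / q = 1"
        "F = (\<Sum>i=1..n. norm (\<alpha> i) powr (2 * p)) powr (1 / p) *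
          (\<Sum>i=1..n. norm (y i) powr (2 * q)) powr (1 / q)"
    | (max_right) "F = (\<Sum>i=1..n. (norm (\<alpha> i))\<^sup>2) * Max ((\<lambda>i. (norm (y i))\<^sup>2) ` {1..n})"
    unfolding diag_bounds_def by blast
  then show ?thesis
  proof cases
    case max_left
    then show ?thesis by (simp add: sum_mult_le_Max_mult_sum)
  next
    case conjugate
    then show ?thesis
      using Hoelder_sum[of "{1..n}" "\<lambda>i. (norm (\<alpha> i))\<^sup>2" "\<lambda>i. (norm (y i))\<^sup>2" p q]
      by (simp add: sq)
  next
    case max_right
    then show ?thesis
      using sum_mult_le_Max_mult_sum[where A = "{1..n}" and f = "\<lambda>i. (norm (y i))\<^sup>2"
          and g = "\<lambda>i. (norm (\<alpha> i))\<^sup>2"]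
      by (simp add: mult.commute)
  qed
qed

lemma finite_offdiag [simp]: "finite (offdiag n)"
proof (rule finite_subset)
  show "offdiag n \<subseteq> {1..n} \<times> {1..n}" by (auto simp: offdiag_def)
qed simp

lemma sum_square_eq_diag_plus_offdiag:
  fixes f :: "nat \<Rightarrow> nat \<Rightarrow> real"
  shows "(\<Sum>i=1..n. \<Sum>j=1..n. f i j) = (\<Sum>i=1..n. f i i) + (\<Sum>(i, j)\<in>offdiag n. f i j)"
proof -
  have square: "{1..n} \<times> {1..n} = (\<lambda>i. (i, i)) ` {1..n} \<union> offdiag n"
    by (auto simp: offdiag_def)
  have "(\<Sum>(i, j)\<in>{1..n} \<times> {1..n}. f i j)
      = (\<Sum>(i, j)\<in>(\<lambda>i. (i, i)) ` {1..n}. f i j) + (\<Sum>(i, j)\<in>offdiag n. f i j)"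
    unfolding square
  proof (rule sum.union_disjoint)
    show "(\<lambda>i. (i, i)) ` {1..n} \<inter> offdiag n = {}" by (auto simp: offdiag_def)
  qed simp_all
  then show ?thesis
    by (simp add: sum.cartesian_product sum.reindex inj_on_def)
qed

lemma sum_offdiag_product:
  fixes a :: "nat \<Rightarrow> real"
  shows "(\<Sum>(i, j)\<in>offdiag n. a i * a j) = (\<Sum>i=1..n. a i)\<^sup>2 - (\<Sum>i=1..n. (a i)\<^sup>2)"
  using sum_square_eq_diag_plus_offdiag[of "\<lambda>i j. a i * a j" n]
  by (simp add: power2_eq_square sum_product)

lemma sum_offdiag_mult_le_Max_offdiag:
  assumes "\<And>i j. 0 \<le> g i j"
  shows "(\<Sum>(i, j)\<in>offdiag n. f i j * g i j) \<le> Max_offdiag n f * (\<Sum>(i, j)\<in>offdiag n. g i j)"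
  using sum_mult_le_Max_mult_sum[of "offdiag n" "\<lambda>(i, j). g i j" "\<lambda>(i, j). f i j"] assms
  by (auto simp: Max_offdiag_def case_prod_unfold)

lemma offdiag_sum_le:
  fixes \<alpha> :: "nat \<Rightarrow> 'k::real_normed_field" and ip :: "'a \<Rightarrow> 'a \<Rightarrow> 'k"
  assumes "G \<in> offdiag_bounds ip n \<alpha> y"
  shows "(\<Sum>(i, j)\<in>offdiag n. norm (\<alpha> i) * norm (\<alpha> j) * norm (ip (y i) (y j))) \<le> G"
proof -
  let ?g = "\<lambda>i j. norm (ip (y i) (y j))"
  from assms consider
      (max_left) "G = Max_offdiag n (\<lambda>i j. norm (\<alpha> i) * norm (\<alpha> j)) * (\<Sum>(i, j)\<in>offdiag n. ?g i j)"
    | (conjugate) r s where "r > 1" "1 / r + 1 / s = 1"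
        "G = ((\<Sum>i=1..n. norm (\<alpha> i) powr r)\<^sup>2 - (\<Sum>i=1..n. norm (\<alpha> i) powr (2 * r))) powr (1 / r)
          * (\<Sum>(i, j)\<in>offdiag n. ?g i j powr s) powr (1 / s)"
    | (max_right) "G = ((\<Sum>i=1..n. norm (\<alpha> i))\<^sup>2 - (\<Sum>i=1..n. (norm (\<alpha> i))\<^sup>2)) * Max_offdiag n ?g"
    unfolding offdiag_bounds_def by blast
  then show ?thesis
  proof cases
    case max_left
    then show ?thesis by (simp add: sum_offdiag_mult_le_Max_offdiag)
  next
    case conjugate
    have "(norm (\<alpha> i) powr r)\<^sup>2 = norm (\<alpha> i) powr (2 * r)" for i
      by (simp add: power2_eq_square flip: powr_add)
    then have "(\<Sum>(i, j)\<in>offdiag n. (norm (\<alpha> i) * norm (\<alpha> j)) powr r)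
        = (\<Sum>i=1..n. norm (\<alpha> i) powr r)\<^sup>2 - (\<Sum>i=1..n. norm (\<alpha> i) powr (2 * r))"
      using sum_offdiag_product[of "\<lambda>i. norm (\<alpha> i) powr r" n] by (simp add: powr_mult)
    then show ?thesis
      using Hoelder_sum[of "offdiag n" "\<lambda>(i, j). norm (\<alpha> i) * norm (\<alpha> j)" "\<lambda>(i, j). ?g i j" r s]
        conjugate
      by (simp add: case_prod_unfold)
  next
    case max_right
    then show ?thesis
      using sum_offdiag_mult_le_Max_offdiag[where n = n and f = ?g
          and g = "\<lambda>i j. norm (\<alpha> i) * norm (\<alpha> j)"]
      by (simp add: sum_offdiag_product mult.commute)
  qed
qed

section \<open>The bound deduced from an expansion of the norm\<close>

text \<open>
  Here \<open>L\<close> stands for the square of the norm of the linear combination, \<open>c\<^sub>i\<close> for the absolute values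
  of its coefficients and \<open>X\<close> for \<open>\<parallel>x\<parallel>\<close>; only these real numbers matter, so the scalars may be real or
  complex.
\<close>

lemma norm_bound_of_expansion:
  fixes \<alpha> :: "nat \<Rightarrow> 'k::real_normed_field" and y :: "nat \<Rightarrow> 'a::real_normed_vector"
    and ip :: "'a \<Rightarrow> 'a \<Rightarrow> 'k"
  assumes F: "F \<in> diag_bounds n \<alpha> y" and G: "G \<in> offdiag_bounds ip n \<alpha> y"
    and expansion: "L \<le> (\<Sum>i=1..n. \<Sum>j=1..n. c i * c j * norm (ip (y i) (y j)))"
    and c: "\<And>i. 0 \<le> c i" "\<And>i. c i \<le> norm (\<alpha> i) * X"
    and ip_self: "\<And>u. norm (ip u u) = (norm u)\<^sup>2"
  shows "L \<le> X\<^sup>2 * F + X\<^sup>2 * G"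
proof -
  let ?D = "\<Sum>i=1..n. (norm (\<alpha> i))\<^sup>2 * (norm (y i))\<^sup>2"
  let ?E = "\<Sum>(i, j)\<in>offdiag n. norm (\<alpha> i) * norm (\<alpha> j) * norm (ip (y i) (y j))"
  note expansion
  also have "(\<Sum>i=1..n. \<Sum>j=1..n. c i * c j * norm (ip (y i) (y j)))
      \<le> (\<Sum>i=1..n. \<Sum>j=1..n. (norm (\<alpha> i) * X) * (norm (\<alpha> j) * X) * norm (ip (y i) (y j)))"
    by (intro sum_mono mult_right_mono mult_mono c order_trans[OF c]) auto
  also have "\<dots> = X\<^sup>2 * (\<Sum>i=1..n. \<Sum>j=1..n. norm (\<alpha> i) * norm (\<alpha> j) * norm (ip (y i) (y j)))"
    by (simp add: sum_distrib_left power2_eq_square mult_ac)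
  also have "\<dots> = X\<^sup>2 * (?D + ?E)"
    by (subst sum_square_eq_diag_plus_offdiag) (simp add: ip_self power2_eq_square)
  also have "\<dots> \<le> X\<^sup>2 * (F + G)"
    by (intro mult_left_mono add_mono diag_sum_le[OF F] offdiag_sum_le[OF G]) simp
  finally show ?thesis by (simp add: distrib_left)
qed

section \<open>Complex inner products\<close>

lemma cinner_add_right: "cinner x (y + z) = cinner x y + cinner x z"
  for x y z :: "'a::complex_inner"
  by (metis cinner_add_left cinner_commute complex_cnj_add)

lemma cinner_scaleC_right: "cinner x (c *\<^sub>C y) = cnj c * cinner x y"
  for x y :: "'a::complex_inner"
  by (metis cinner_commute cinner_scaleC_left complex_cnj_mult)

lemma cinner_sum_left: "cinner (\<Sum>i\<in>A. f i) z = (\<Sum>i\<in>A. cinner (f i) z)"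
  for z :: "'a::complex_inner"
proof (rule Modules.additive.sum)
  show "Modules.additive (\<lambda>x. cinner x z)" by standard (rule cinner_add_left)
qed

lemma cinner_sum_right: "cinner z (\<Sum>i\<in>A. f i) = (\<Sum>i\<in>A. cinner z (f i))"
  for z :: "'a::complex_inner"
proof (rule Modules.additive.sum)
  show "Modules.additive (cinner z)" by standard (rule cinner_add_right)
qed

lemma cinner_self: "cinner x x = complex_of_real ((norm x)\<^sup>2)"
  for x :: "'a::complex_inner"
proof -
  have "Im (cinner x x) = 0"
    using arg_cong[OF cinner_commute[of x x], of Im] by simp
  then show ?thesis
    by (simp add: complex_eq_iff norm_eq_sqrt_cinner cinner_ge_zero)
qed

lemma norm_scaleC: "norm (c *\<^sub>C x) = cmod c * norm x"
  for x :: "'a::complex_inner"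
proof -
  have "complex_of_real ((norm (c *\<^sub>C x))\<^sup>2) = c * cnj c * cinner x x"
    by (simp only: cinner_scaleC_left cinner_scaleC_right mult_ac flip: cinner_self)
  also have "\<dots> = complex_of_real ((cmod c * norm x)\<^sup>2)"
    by (simp add: cinner_self power_mult_distrib flip: complex_norm_square)
  finally have "(norm (c *\<^sub>C x))\<^sup>2 = (cmod c * norm x)\<^sup>2"
    by (simp only: of_real_eq_iff)
  then show ?thesis by simp
qed

text \<open>
  Since the norm is known to satisfy the triangle inequality, comparing the squares of both sides of
  \<open>\<parallel>x + y\<parallel> \<le> \<parallel>x\<parallel> + \<parallel>y\<parallel>\<close> bounds the real part of \<open>(x, y)\<close>; rotating \<open>y\<close> by a unimodular scalar makes
  \<open>(x, y)\<close> equal to its absolute value.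
\<close>

lemma cinner_Cauchy_Schwarz: "cmod (cinner x y) \<le> norm x * norm y"
  for x y :: "'a::complex_inner"
proof -
  have Re_le: "Re (cinner x z) \<le> norm x * norm z" for z
  proof -
    have "Re (cinner z x) = Re (cinner x z)"
      by (subst cinner_commute) simp
    moreover have "(norm (x + z))\<^sup>2 = Re (cinner (x + z) (x + z))"
      by (simp add: cinner_self)
    ultimately have "(norm (x + z))\<^sup>2 = (norm x)\<^sup>2 + 2 * Re (cinner x z) + (norm z)\<^sup>2"
      by (simp add: cinner_add_left cinner_add_right cinner_self[of x] cinner_self[of z])
    moreover have "(norm (x + z))\<^sup>2 \<le> (norm x + norm z)\<^sup>2"
      by (intro power_mono norm_triangle_ineq) simp
    ultimately show ?thesis by (simp add: power2_sum)
  qed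
  show ?thesis
  proof (cases "cinner x y = 0")
    case False
    define u where "u = sgn (cinner x y)"
    have u: "cmod u = 1" using False by (simp add: u_def norm_sgn)
    have "cinner x y = complex_of_real (cmod (cinner x y)) * u"
      using False by (simp add: u_def sgn_eq)
    then have "cinner x (u *\<^sub>C y) = complex_of_real (cmod (cinner x y)) * (u * cnj u)"
      by (simp add: cinner_scaleC_right)
    then have "cmod (cinner x y) = Re (cinner x (u *\<^sub>C y))"
      using u by (simp flip: complex_norm_square)
    also have "\<dots> \<le> norm x * norm y"
      using Re_le[of "u *\<^sub>C y"] u by (simp add: norm_scaleC)
    finally show ?thesis .
  qed simp
qed

section \<open>The inequality over the real and over the complex scalars\<close>

lemma norm_sum_scaleR_squared_le:
  fixes y :: "'i \<Rightarrow> 'a::real_inner"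
  shows "(norm (\<Sum>i\<in>A. c i *\<^sub>R y i))\<^sup>2 \<le> (\<Sum>i\<in>A. \<Sum>j\<in>A. \<bar>c i\<bar> * \<bar>c j\<bar> * \<bar>inner (y i) (y j)\<bar>)"
proof -
  have "(norm (\<Sum>i\<in>A. c i *\<^sub>R y i))\<^sup>2 = (\<Sum>i\<in>A. \<Sum>j\<in>A. c i * c j * inner (y i) (y j))"
    by (simp add: power2_norm_eq_inner inner_sum_left inner_sum_right sum_distrib_left
        mult.assoc mult.left_commute inner_commute)
  also have "\<dots> \<le> (\<Sum>i\<in>A. \<Sum>j\<in>A. \<bar>c i\<bar> * \<bar>c j\<bar> * \<bar>inner (y i) (y j)\<bar>)"
    by (intro sum_mono) (metis abs_ge_self abs_mult)
  finally show ?thesis .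
qed

lemma norm_sum_scaleC_squared_le:
  fixes y :: "'i \<Rightarrow> 'a::complex_inner"
  shows "(norm (\<Sum>i\<in>A. c i *\<^sub>C y i))\<^sup>2
    \<le> (\<Sum>i\<in>A. \<Sum>j\<in>A. cmod (c i) * cmod (c j) * cmod (cinner (y i) (y j)))"
proof -
  have "(norm (\<Sum>i\<in>A. c i *\<^sub>C y i))\<^sup>2 = cmod (cinner (\<Sum>i\<in>A. c i *\<^sub>C y i) (\<Sum>i\<in>A. c i *\<^sub>C y i))"
    by (simp add: cinner_self norm_power)
  also have "\<dots> = cmod (\<Sum>i\<in>A. \<Sum>j\<in>A. c i * (cnj (c j) * cinner (y i) (y j)))"
    by (simp only: cinner_sum_left cinner_scaleC_left)
       (simp only: cinner_sum_right cinner_scaleC_right sum_distrib_left)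
  also have "\<dots> \<le> (\<Sum>i\<in>A. \<Sum>j\<in>A. cmod (c i * (cnj (c j) * cinner (y i) (y j))))"
    by (intro order_trans[OF norm_sum] sum_mono norm_sum)
  finally show ?thesis by (simp add: norm_mult mult_ac)
qed

theorem theorem3:
  fixes n :: nat
  assumes "n \<ge> 1"
  shows
    "(\<forall>(x :: 'a::{real_inner, complete_space}) (y :: nat \<Rightarrow> 'a) (\<alpha> :: nat \<Rightarrow> real).
        (\<forall>i\<in>{1..n}. y i \<noteq> 0) \<longrightarrow>
        (\<forall>F \<in> diag_bounds n \<alpha> y. \<forall>G \<in> offdiag_bounds inner n \<alpha> y.
          (norm (\<Sum>i=1..n. (\<alpha> i * (inner x (y i) / norm (y i))) *\<^sub>R y i))\<^sup>2
            \<le> (norm x)\<^sup>2 * F + (norm x)\<^sup>2 * G)) \<and>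
     (\<forall>(x :: 'b::complex_hilbert) (y :: nat \<Rightarrow> 'b) (\<alpha> :: nat \<Rightarrow> complex).
        (\<forall>i\<in>{1..n}. y i \<noteq> 0) \<longrightarrow>
        (\<forall>F \<in> diag_bounds n \<alpha> y. \<forall>G \<in> offdiag_bounds cinner n \<alpha> y.
          (norm (\<Sum>i=1..n. (\<alpha> i * (cinner x (y i) / complex_of_real (norm (y i)))) *\<^sub>C y i))\<^sup>2
            \<le> (norm x)\<^sup>2 * F + (norm x)\<^sup>2 * G))"
proof (intro conjI allI impI ballI)
  fix x :: 'a and y :: "nat \<Rightarrow> 'a" and \<alpha> :: "nat \<Rightarrow> real" and F G :: real
  assume F: "F \<in> diag_bounds n \<alpha> y" and G: "G \<in> offdiag_bounds inner n \<alpha> y"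
  let ?c = "\<lambda>i. \<alpha> i * (inner x (y i) / norm (y i))"
  \<comment> \<open>Outside \<open>{1..n}\<close> the vector \<open>y i\<close> may vanish; the quotient is then \<open>0\<close> by convention.\<close>
  have "\<bar>inner x (y i) / norm (y i)\<bar> \<le> norm x" for i
    using Cauchy_Schwarz_ineq2[of x "y i"] by (cases "y i = 0") (auto simp: field_simps)
  then have "\<bar>?c i\<bar> \<le> norm (\<alpha> i) * norm x" for i
    by (simp only: abs_mult real_norm_def) (intro mult_left_mono; simp)
  then show "(norm (\<Sum>i=1..n. ?c i *\<^sub>R y i))\<^sup>2 \<le> (norm x)\<^sup>2 * F + (norm x)\<^sup>2 * G"
    using norm_sum_scaleR_squared_le[of ?c y "{1..n}"]
    by (intro norm_bound_of_expansion[OF F G, where c = "\<lambda>i. \<bar>?c i\<bar>"])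
       (auto simp: power2_norm_eq_inner simp del: abs_mult)
next
  fix x :: 'b and y :: "nat \<Rightarrow> 'b" and \<alpha> :: "nat \<Rightarrow> complex" and F G :: real
  assume F: "F \<in> diag_bounds n \<alpha> y" and G: "G \<in> offdiag_bounds cinner n \<alpha> y"
  let ?c = "\<lambda>i. \<alpha> i * (cinner x (y i) / complex_of_real (norm (y i)))"
  have "cmod (cinner x (y i) / complex_of_real (norm (y i))) \<le> norm x" for i
    using cinner_Cauchy_Schwarz[of x "y i"]
    by (cases "y i = 0") (auto simp: norm_divide field_simps)
  then have "cmod (?c i) \<le> norm (\<alpha> i) * norm x" for i
    by (simp only: norm_mult) (intro mult_left_mono; simp)
  then show "(norm (\<Sum>i=1..n. ?c i *\<^sub>C y i))\<^sup>2 \<le> (norm x)\<^sup>2 * F + (norm x)\<^sup>2 * G"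
    using norm_sum_scaleC_squared_le[of ?c y "{1..n}"]
    by (intro norm_bound_of_expansion[OF F G, where c = "\<lambda>i. cmod (?c i)"])
       (simp_all add: cinner_self norm_power del: norm_mult)
qed

end
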